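(* For every real number $s\ge 0$ there exists a finite set $\mathcal{T}_s$ of multilinear polynomials (each $f\in\mathcal{T}_s$ being a polynomial in some number $r=r(f)\ge 0$ of variables) such that a natural number $n$ satisfies $\delta(n)<s$ if and only if there exist $f\in\mathcal{T}_s$ and nonnegative integers $k_1,\ldots,k_{r+1}$ with \[ n=f(3^{k_1},\ldots,3^{k_r})\,3^{k_{r+1}}. \] In other words, \[ \{ n\in\mathbb{N} : \delta(n)<s \} = \bigcup_{f\in\mathcal{T}_s} \{f(3^{k_1},\ldots,3^{k_r})3^{k_{r+1}} : k_1,\ldots,k_{r+1}\ge 0 \}. \]
   Context: For a natural number $n$, its complexity $\|n\|$ is the smallest number of $1$'s needed to write $n$ using only the constant $1$, addition, multiplication and parentheses (in any legal nesting). The defect of $n$ is $\delta(n):=\|n\|-3\log_3 n$. *)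

theory Defs
  imports Complex_Main "HOL-Library.Poly_Mapping"
begin

datatype ones_expr = One | Add ones_expr ones_expr | Mul ones_expr ones_expr

primrec ones_value :: "ones_expr \<Rightarrow> nat" where
  "ones_value One = 1"
| "ones_value (Add a b) = ones_value a + ones_value b"
| "ones_value (Mul a b) = ones_value a * ones_value b"

primrec ones_count :: "ones_expr \<Rightarrow> nat" where
  "ones_count One = 1"
| "ones_count (Add a b) = ones_count a + ones_count b"
| "ones_count (Mul a b) = ones_count a + ones_count b"

text \<open>The number 0 is not the value of any expression, so the complexity (and hence the defect)
  is meaningful for positive arguments only.\<close>

definition complexity :: "nat \<Rightarrow> nat" where
  "complexity n = (LEAST m. \<exists>e. ones_value e = n \<and> ones_count e = m)"

lemma ex_ones_expr: "0 < n \<Longrightarrow> \<exists>e. ones_value e = n"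
proof (induction n)
  case (Suc n)
  show ?case
  proof (cases "n = 0")
    case True
    then show ?thesis by (intro exI[of _ One]) simp
  next
    case False
    with Suc.IH obtain e where "ones_value e = n" by auto
    then show ?thesis by (intro exI[of _ "Add e One"]) simp
  qed
qed simp

definition defect :: "nat \<Rightarrow> real" where
  "defect n = real (complexity n) - 3 * log 3 (real n)"

text \<open>A multivariate polynomial is a finitely supported map from monomials to coefficients, and
  a monomial is a finitely supported map from variable indices to exponents. With this reading,
  the ring operations of \<^type>\<open>poly_mapping\<close> are those of the polynomial ring. A polynomial in
  \<open>r\<close> variables uses the indices \<open>0, \<dots>, r - 1\<close>; it need not involve all of them.\<close>

type_synonym 'a mpoly = "(nat \<Rightarrow>\<^sub>0 nat) \<Rightarrow>\<^sub>0 'a"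

definition mpoly_eval :: "'a::comm_semiring_1 mpoly \<Rightarrow> (nat \<Rightarrow> 'a) \<Rightarrow> 'a" where
  "mpoly_eval f x =
    (\<Sum>m\<in>Poly_Mapping.keys f. Poly_Mapping.lookup f m *
       (\<Prod>i\<in>Poly_Mapping.keys m. x i ^ Poly_Mapping.lookup m i))"

definition mpoly_vars :: "'a::zero mpoly \<Rightarrow> nat set" where
  "mpoly_vars f = (\<Union>m\<in>Poly_Mapping.keys f. Poly_Mapping.keys m)"

definition multilinear :: "'a::zero mpoly \<Rightarrow> bool" where
  "multilinear f \<longleftrightarrow> (\<forall>m\<in>Poly_Mapping.keys f. \<forall>i. Poly_Mapping.lookup m i \<le> 1)"

end

theory Submission
  imports Defs
begin

text \<open>
  A family is a positive function \<open>F\<close> of exponents \<open>k\<^sub>0, \<dots>, k\<^sub>r\<^sub>-\<^sub>1\<close>, multilinear in the powers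
  \<open>3 ^ k\<^sub>i\<close>, together with a cost \<open>C\<close> such that \<open>F k\<close> has complexity at most \<open>C + 3 * (\<Sum>i<r. k i)\<close>.
  Numbers of defect less than \<open>t + 1/10\<close> are covered, with equality in this bound, by finitely many
  families: in an optimal sum \<open>n = a + b\<close> with \<open>b \<le> a\<close> and \<open>n \<ge> 6\<close>, the defect of \<open>a\<close> is smaller than
  that of \<open>n\<close> by at least \<open>1/2\<close> and \<open>b\<close> is bounded; in an optimal product both factors have defect
  less than \<open>t\<close>, unless one of them has defect less than \<open>1/10\<close> and hence is a power of 3.

  The bound on the defect of \<open>F k\<close> which a family provides is monotone in every \<open>k i\<close>. So the exponents
  for which it is less than \<open>s\<close> form a downward closed subset of \<open>\<nat>\<^sup>r\<close>, and such a set is a finite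
  union of sets given by fixing some of the coordinates. Fixing exponents preserves multilinearity.
\<close>

section \<open>Complexity and defect\<close>

lemma ones_value_pos: "0 < ones_value e"
  by (induction e) auto

lemma ones_count_pos: "0 < ones_count e"
  by (induction e) auto

lemma ones_count_1_imp_value_1: "ones_count e = 1 \<Longrightarrow> ones_value e = 1"
proof (cases e)
  case (Add a b)
  then show "ones_count e = 1 \<Longrightarrow> ones_value e = 1"
    using ones_count_pos[of a] ones_count_pos[of b] by simp
next
  case (Mul a b)
  then show "ones_count e = 1 \<Longrightarrow> ones_value e = 1"
    using ones_count_pos[of a] ones_count_pos[of b] by simp
qed simp

text \<open>This is the addition step of the bound by a power of 3. If \<open>q \<ge> 2\<close>,
  doubling \<open>a\<close> multiplies the cube by 8, and 8 \<le> 9 \<le> \<open>3 ^ q\<close>. If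
  \<open>q = 1\<close>, only a factor 3 is available: it suffices for \<open>a \<ge> 3\<close>,
  because 64/27 < 3, and \<open>a = 1\<close> and \<open>a = 2\<close> are computed.\<close>

lemma cube_add_le:
  fixes a b p q :: nat
  assumes "a ^ 3 \<le> 3 ^ p" "b \<le> a" "p \<ge> 1" "q \<ge> 1" "q = 1 \<Longrightarrow> b = 1" "b \<ge> 1"
  shows "(a + b) ^ 3 \<le> 3 ^ (p + q)"
proof (cases "q = 1")
  case False
  then have "(3::nat) ^ 2 \<le> 3 ^ q" using assms(4) by (intro power_increasing) auto
  have "(a + b) ^ 3 \<le> (2 * a) ^ 3" using assms(2) by (intro power_mono) auto
  also have "\<dots> = 8 * a ^ 3" by (simp add: power_mult_distrib)
  also have "\<dots> \<le> 3 ^ q * 3 ^ p" using \<open>(3::nat) ^ 2 \<le> 3 ^ q\<close> assms(1) by (intro mult_mono) auto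
  finally show ?thesis by (simp add: power_add mult.commute)
next
  case True
  then have b: "b = 1" using assms by simp
  consider "a = 1" | "a = 2" | "a \<ge> 3" using assms by linarith
  then show ?thesis
  proof cases
    case 1
    have "(3::nat) ^ 2 \<le> 3 ^ (p + q)" using assms by (intro power_increasing) auto
    moreover have "a + b = 2" using 1 b by simp
    ultimately show ?thesis by simp
  next
    case 2
    \<comment> \<open>Since 8 > 3, the value 2 costs at least two ones, so
      \<open>p + q \<ge> 3\<close> and the bound 27 \<le> 27 is attained.\<close>
    have "p \<noteq> 1" using assms(1) 2 by auto
    then have "(3::nat) ^ 3 \<le> 3 ^ (p + q)" using assms by (intro power_increasing) auto
    then show ?thesis using 2 b by simp
  next
    case 3
    have "3 * (a + 1) \<le> 4 * a" using 3 by simp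
    then have "(3 * (a + 1)) ^ 3 \<le> (4 * a) ^ 3" by (intro power_mono) auto
    then have "27 * (a + 1) ^ 3 \<le> 64 * a ^ 3" by (simp only: power_mult_distrib) simp
    then have "(a + 1) ^ 3 \<le> 3 * a ^ 3" by linarith
    then show ?thesis using True b assms(1) by simp
  qed
qed

text \<open>Nonnegativity of the defect, cubed so that it becomes a statement about natural numbers
  and needs no logarithm.\<close>

lemma ones_value_cube_le: "ones_value e ^ 3 \<le> 3 ^ ones_count e"
proof (induction e)
  case (Add a b)
  have pos: "ones_count a \<ge> 1" "ones_count b \<ge> 1" "ones_value a \<ge> 1" "ones_value b \<ge> 1"
    using ones_count_pos ones_value_pos by (simp_all add: Suc_le_eq)
  show ?case
  proof (cases "ones_value b \<le> ones_value a")
    case True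
    then show ?thesis using cube_add_le Add pos ones_count_1_imp_value_1 by simp
  next
    case False
    then show ?thesis
      using cube_add_le[of "ones_value b" "ones_count b" "ones_value a" "ones_count a"]
        Add pos ones_count_1_imp_value_1[of a] by (simp add: add.commute)
  qed
next
  case (Mul a b)
  then show ?case by (simp add: power_mult_distrib power_add mult_mono)
qed simp

section \<open>Subadditivity, lower bounds and optimal decompositions\<close>

lemma complexity_le: "ones_value e = n \<Longrightarrow> complexity n \<le> ones_count e"
  unfolding complexity_def by (rule Least_le) blast

lemma complexity_witness:
  assumes "n > 0"
  obtains e where "ones_value e = n" "ones_count e = complexity n"
proof -
  have "\<exists>e. ones_value e = n \<and> ones_count e = complexity n"
    unfolding complexity_def by (rule LeastI_ex) (use ex_ones_expr[OF assms] in blast)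
  then show ?thesis using that by blast
qed

lemma complexity_add:
  assumes "a > 0" "b > 0"
  shows "complexity (a + b) \<le> complexity a + complexity b"
proof -
  obtain x where x: "ones_value x = a" "ones_count x = complexity a"
    by (rule complexity_witness[OF assms(1)])
  obtain y where y: "ones_value y = b" "ones_count y = complexity b"
    by (rule complexity_witness[OF assms(2)])
  show ?thesis using complexity_le[of "Add x y" "a + b"] x y by simp
qed

lemma complexity_mult:
  assumes "a > 0" "b > 0"
  shows "complexity (a * b) \<le> complexity a + complexity b"
proof -
  obtain x where x: "ones_value x = a" "ones_count x = complexity a"
    by (rule complexity_witness[OF assms(1)])
  obtain y where y: "ones_value y = b" "ones_count y = complexity b"
    by (rule complexity_witness[OF assms(2)])
  show ?thesis using complexity_le[of "Mul x y" "a * b"] x y by simp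
qed

lemma complexity_1: "complexity 1 = 1"
proof (rule antisym)
  show "complexity 1 \<le> 1" using complexity_le[of One 1] by simp
  obtain e where "ones_count e = complexity 1" by (rule complexity_witness[OF zero_less_one])
  then show "1 \<le> complexity 1" using ones_count_pos[of e] by simp
qed

lemma complexity_3: "complexity 3 \<le> 3"
  using complexity_le[of "Add One (Add One One)" 3] by simp

lemma complexity_mult_pow3: "n > 0 \<Longrightarrow> complexity (n * 3 ^ j) \<le> complexity n + 3 * j"
proof (induction j)
  case (Suc j)
  have "complexity (n * 3 ^ j * 3) \<le> complexity (n * 3 ^ j) + complexity 3"
    using Suc.prems by (intro complexity_mult) auto
  then show ?case using Suc complexity_3 by (simp add: mult_ac)
qed simp

lemma cube_le_complexity:
  assumes "n > 0"
  shows "n ^ 3 \<le> 3 ^ complexity n"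
proof -
  obtain e where "ones_value e = n" "ones_count e = complexity n"
    by (rule complexity_witness[OF assms])
  then show ?thesis using ones_value_cube_le[of e] by simp
qed

lemma complexity_ge_of_cube:
  assumes "n > 0" "3 ^ c < n ^ 3"
  shows "Suc c \<le> complexity n"
proof -
  have "(3::nat) ^ c < 3 ^ complexity n" using assms cube_le_complexity le_trans less_le_trans by blast
  then show ?thesis by (simp add: Suc_le_eq)
qed

text \<open>The last operation of an optimal expression gives the case. Subadditivity forces both
  operands to be written optimally, and a factor 1 would waste a one.\<close>

lemma complexity_cases:
  assumes "n \<ge> 2"
  obtains (sum) a b where "n = a + b" "0 < b" "b \<le> a" "complexity n = complexity a + complexity b"
  | (product) a b where "n = a * b" "1 < a" "1 < b" "complexity n = complexity a + complexity b"
proof -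
  obtain e where e: "ones_value e = n" "ones_count e = complexity n"
    by (rule complexity_witness[of n]) (use assms in auto)
  show ?thesis
  proof (cases e)
    case One
    then show ?thesis using e assms by simp
  next
    case (Add x y)
    let ?a = "ones_value x" and ?b = "ones_value y"
    have n: "n = ?a + ?b" using e Add by simp
    have "complexity ?a + complexity ?b \<le> complexity n"
      using complexity_le[of x] complexity_le[of y] e Add by (simp add: add_mono)
    then have c: "complexity n = complexity ?a + complexity ?b"
      using complexity_add[of ?a ?b] n ones_value_pos by simp
    show ?thesis
      using sum[of ?a ?b] sum[of ?b ?a] n c ones_value_pos by (cases "?b \<le> ?a") auto
  next
    case (Mul x y)
    let ?a = "ones_value x" and ?b = "ones_value y"
    have n: "n = ?a * ?b" using e Mul by simp
    have "complexity ?a + complexity ?b \<le> complexity n"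
      using complexity_le[of x] complexity_le[of y] e Mul by (simp add: add_mono)
    then have c: "complexity n = complexity ?a + complexity ?b"
      using complexity_mult[of ?a ?b] n ones_value_pos by simp
    have pos: "0 < ?a" "0 < ?b" by (rule ones_value_pos)+
    have "?a \<noteq> 1"
    proof
      assume a: "?a = 1"
      then have "n = ?b" using n by simp
      then show False using c a complexity_1 by simp
    qed
    moreover have "?b \<noteq> 1"
    proof
      assume b: "?b = 1"
      then have "n = ?a" using n by simp
      then show False using c b complexity_1 by simp
    qed
    ultimately show ?thesis using product[of ?a ?b] n c pos by simp
  qed
qed

section \<open>The defect under products, powers of 3 and sums\<close>

lemma defect_nonneg:
  assumes "n > 0"
  shows "0 \<le> defect n"
proof -
  have "real (n ^ 3) \<le> real (3 ^ complexity n)"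
    using cube_le_complexity[OF assms] by (simp only: of_nat_le_iff)
  then have "log 3 (real n ^ 3) \<le> log 3 (3 ^ complexity n)"
    using assms by (subst log_le_cancel_iff) auto
  moreover have "log 3 (real n ^ 3) = 3 * log 3 (real n)" using assms by (simp add: log_nat_power)
  ultimately show ?thesis by (simp add: defect_def)
qed

lemma defect_mult:
  assumes "a > 0" "b > 0" "complexity (a * b) = complexity a + complexity b"
  shows "defect (a * b) = defect a + defect b"
  using assms by (simp add: defect_def log_mult)

lemma defect_mult_pow3_le:
  assumes "n > 0"
  shows "defect (n * 3 ^ j) \<le> defect n"
proof -
  have "log 3 (real (n * 3 ^ j)) = log 3 (real n) + real j"
    using assms by (simp add: log_mult log_nat_power)
  then show ?thesis using complexity_mult_pow3[OF assms, of j] by (simp add: defect_def)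
qed

text \<open>The difference of the defects is \<open>complexity b - 3 * log 3 ((a + b) / a)\<close>.
  The condition \<open>6 \<le> a + b\<close> keeps the ratio small: at most 6/5 for
  \<open>b = 1\<close> and 3/2 for \<open>b = 2\<close>; for \<open>b \<ge> 3\<close> it is at most
  2, while \<open>b\<close> costs at least three ones.\<close>

lemma defect_sum_ge:
  assumes "0 < b" "b \<le> a" "6 \<le> a + b" "complexity (a + b) = complexity a + complexity b"
  shows "defect a + 1 / 2 \<le> defect (a + b)"
proof -
  define c where "c = complexity b"
  \<comment> \<open>The claim multiplied by 2 and exponentiated to base 3.\<close>
  have key: "(a + b) ^ 6 * 3 \<le> a ^ 6 * 3 ^ (2 * c)"
  proof -
    consider "b = 1" | "b = 2" | "b \<ge> 3" using assms by linarith
    then show ?thesis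
    proof cases
      case 1
      \<comment> \<open>The tightest case: 3 * 46656 = 139968 lies just below 9 * 15625 =
        140625.\<close>
      then have "5 * (a + b) \<le> 6 * a" using assms by simp
      then have "(5 * (a + b)) ^ 6 \<le> (6 * a) ^ 6" by (intro power_mono) auto
      then have "15625 * (a + b) ^ 6 \<le> 46656 * a ^ 6" by (simp only: power_mult_distrib) simp
      then have "(a + b) ^ 6 * 3 \<le> a ^ 6 * 3 ^ 2" by simp
      then show ?thesis using 1 complexity_1 by (simp add: c_def)
    next
      case 2
      then have "2 * (a + b) \<le> 3 * a" using assms by simp
      then have "(2 * (a + b)) ^ 6 \<le> (3 * a) ^ 6" by (intro power_mono) auto
      then have "64 * (a + b) ^ 6 \<le> 729 * a ^ 6" by (simp only: power_mult_distrib) simp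
      then have "(a + b) ^ 6 * 3 \<le> a ^ 6 * 3 ^ 4" by simp
      also have "Suc 1 \<le> c" unfolding c_def using 2 by (intro complexity_ge_of_cube) auto
      then have "(3::nat) ^ 4 \<le> 3 ^ (2 * c)" by (intro power_increasing) auto
      then have "a ^ 6 * 3 ^ 4 \<le> a ^ 6 * 3 ^ (2 * c)" by simp
      finally show ?thesis .
    next
      case 3
      have "(a + b) ^ 6 \<le> (2 * a) ^ 6" using assms by (intro power_mono) auto
      then have "(a + b) ^ 6 \<le> 64 * a ^ 6" by (simp only: power_mult_distrib) simp
      then have "(a + b) ^ 6 * 3 \<le> a ^ 6 * 3 ^ 6" by simp
      also have "(3::nat) ^ 3 \<le> b ^ 3" using 3 by (intro power_mono) auto
      then have "Suc 2 \<le> c" unfolding c_def using 3 by (intro complexity_ge_of_cube) auto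
      then have "(3::nat) ^ 6 \<le> 3 ^ (2 * c)" by (intro power_increasing) auto
      then have "a ^ 6 * 3 ^ 6 \<le> a ^ 6 * 3 ^ (2 * c)" by simp
      finally show ?thesis .
    qed
  qed
  have pos: "0 < real (a + b)" "0 < real a" using assms by auto
  have "real ((a + b) ^ 6 * 3) \<le> real (a ^ 6 * 3 ^ (2 * c))" using key by (simp only: of_nat_le_iff)
  then have "log 3 (real (a + b) ^ 6 * 3) \<le> log 3 (real a ^ 6 * 3 ^ (2 * c))"
    using pos by (subst log_le_cancel_iff) auto
  moreover have "log 3 (real (a + b) ^ 6 * 3) = 6 * log 3 (real (a + b)) + 1"
    using pos by (subst log_mult) (auto simp: log_nat_power)
  moreover have "log 3 (real a ^ 6 * 3 ^ (2 * c)) = 6 * log 3 (real a) + 2 * real c"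
    using pos by (subst log_mult) (auto simp: log_nat_power)
  ultimately show ?thesis using assms(4) by (simp add: defect_def c_def)
qed

text \<open>Since \<open>a + b \<le> 2 * a\<close> and 8 \<le> 9, the sum exceeds \<open>a\<close>
  by at most 2 in \<open>3 * log 3\<close>, and \<open>a\<close> has nonnegative defect. A bound on
  the defect thus leaves only finitely many possible smaller summands.\<close>

lemma complexity_summand_le:
  assumes "0 < b" "b \<le> a" "complexity (a + b) = complexity a + complexity b"
  shows "real (complexity b) \<le> defect (a + b) + 2"
proof -
  have pos: "0 < real (a + b)" "0 < real a" using assms by auto
  have "(a + b) ^ 3 \<le> (2 * a) ^ 3" using assms by (intro power_mono) auto
  then have "(a + b) ^ 3 \<le> a ^ 3 * 3 ^ 2" by (simp add: power_mult_distrib)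
  then have "real ((a + b) ^ 3) \<le> real (a ^ 3 * 3 ^ 2)" by (simp only: of_nat_le_iff)
  then have "log 3 (real (a + b) ^ 3) \<le> log 3 (real a ^ 3 * 3 ^ 2)"
    using pos by (subst log_le_cancel_iff) auto
  moreover have "log 3 (real (a + b) ^ 3) = 3 * log 3 (real (a + b))"
    using pos by (simp add: log_nat_power)
  moreover have "log 3 (real a ^ 3 * 3 ^ 2) = 3 * log 3 (real a) + 2"
    using pos log_nat_power[of 3 3 2] by (subst log_mult) (auto simp: log_nat_power simp del: power2_eq_square)
  moreover have "0 \<le> defect a" using assms by (intro defect_nonneg) auto
  ultimately show ?thesis using assms(3) by (simp add: defect_def)
qed

text \<open>The constant 1/10 lies just below the defect of 2, which is about 0.107. The inequality
  \<open>v ^ 30 * 3 \<le> 3 ^ (10 * complexity v)\<close> is the claim multiplied by 10 and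
  exponentiated.\<close>

lemma defect_small_ge:
  assumes "v \<in> {1, 2, 4, 5}"
  shows "1 / 10 \<le> defect v"
proof -
  have "v ^ 30 * 3 \<le> 3 ^ (10 * complexity v)"
  proof -
    \<comment> \<open>The witness \<open>c\<close> is one less than the complexity of
      \<open>v\<close>, certified by \<open>3 ^ c < v ^ 3\<close> when \<open>v > 1\<close>.\<close>
    have "\<exists>c. v ^ 30 * 3 \<le> 3 ^ (10 * Suc c) \<and> Suc c \<le> complexity v"
    proof -
      consider "v = 1" | "v = 2" | "v = 4" | "v = 5" using assms by blast
      then show ?thesis
      proof cases
        case 1
        then show ?thesis using complexity_1 by (intro exI[of _ 0]) simp
      next
        case 2
        then show ?thesis using complexity_ge_of_cube[of 2 1] by (intro exI[of _ 1]) simp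
      next
        case 3
        then show ?thesis using complexity_ge_of_cube[of 4 3] by (intro exI[of _ 3]) simp
      next
        case 4
        then show ?thesis using complexity_ge_of_cube[of 5 4] by (intro exI[of _ 4]) simp
      qed
    qed
    then obtain c where c: "v ^ 30 * 3 \<le> 3 ^ (10 * Suc c)" "Suc c \<le> complexity v" by blast
    note c(1)
    also have "(3::nat) ^ (10 * Suc c) \<le> 3 ^ (10 * complexity v)"
      using c(2) by (intro power_increasing) auto
    finally show ?thesis .
  qed
  then have "real (v ^ 30 * 3) \<le> real (3 ^ (10 * complexity v))" by (simp only: of_nat_le_iff)
  moreover have pos: "0 < real v" using assms by auto
  ultimately have "log 3 (real v ^ 30 * 3) \<le> log 3 (3 ^ (10 * complexity v))"
    by (subst log_le_cancel_iff) auto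
  moreover have "log 3 (real v ^ 30 * 3) = 30 * log 3 (real v) + 1"
    using pos by (subst log_mult) (auto simp: log_nat_power)
  moreover have "log 3 (3 ^ (10 * complexity v)) = 10 * real (complexity v)"
    by (simp add: log_nat_power)
  ultimately show ?thesis by (simp add: defect_def)
qed

text \<open>Beyond 5 an optimal sum has defect at least 1/2, so only products remain; defects add
  there, so both factors are again below 1/10. Up to 5 only 3 qualifies.\<close>

lemma defect_lt_imp_pow3:
  assumes "v > 0" "defect v < 1 / 10"
  shows "\<exists>j. v = 3 ^ j"
  using assms
proof (induction v rule: less_induct)
  case (less v)
  show ?case
  proof (cases "v \<le> 5")
    case True
    have "v \<notin> {1, 2, 4, 5}" using defect_small_ge less.prems(2) by force
    then have "v = 3 ^ 1" using True less.prems(1) by auto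
    then show ?thesis by blast
  next
    case False
    then have "v \<ge> 2" by simp
    then show ?thesis
    proof (cases rule: complexity_cases)
      case (sum a b)
      then have "defect a + 1 / 2 \<le> defect v" using False defect_sum_ge[of b a] by simp
      moreover have "0 \<le> defect a" using sum by (intro defect_nonneg) auto
      ultimately show ?thesis using less.prems by simp
    next
      case (product a b)
      have d: "defect v = defect a + defect b" using product defect_mult[of a b] by simp
      have nn: "0 \<le> defect a" "0 \<le> defect b" using product by (auto intro: defect_nonneg)
      have "\<exists>i. a = 3 ^ i" using less.IH[of a] product d nn less.prems by simp
      moreover have "\<exists>i. b = 3 ^ i" using less.IH[of b] product d nn less.prems by simp
      ultimately show ?thesis using product(1) by (metis power_add)
    qed
  qed
qed

text \<open>The exponent 0 is an exception, because \<open>complexity 1 = 1\<close>.\<close>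

lemma complexity_pow3:
  assumes "j > 0"
  shows "complexity (3 ^ j) = 3 * j"
proof (rule antisym)
  obtain i where j: "j = Suc i" using assms by (cases j) auto
  show "complexity (3 ^ j) \<le> 3 * j"
    using complexity_mult_pow3[of 3 i] complexity_3 by (simp add: j)
  have "(3::nat) ^ (3 * j) \<le> 3 ^ complexity (3 ^ j)"
    using cube_le_complexity[of "3 ^ j"] by (simp add: power_mult mult.commute)
  then show "3 * j \<le> complexity (3 ^ j)" by simp
qed

section \<open>Multilinear functions of powers of 3\<close>

text \<open>Multilinearity is expressed on functions, splitting off the last variable. Closure
  properties then follow by induction on \<open>r\<close> without polynomial arithmetic, and actual
  polynomials are produced only afterwards.\<close>

primrec mlin :: "nat \<Rightarrow> ((nat \<Rightarrow> nat) \<Rightarrow> int) \<Rightarrow> bool" where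
  "mlin 0 F \<longleftrightarrow> (\<exists>c. F = (\<lambda>_. c))"
| "mlin (Suc r) F \<longleftrightarrow> (\<exists>G H. mlin r G \<and> mlin r H \<and> F = (\<lambda>k. G k * 3 ^ k r + H k))"

lemma mlin_SucI: "mlin r G \<Longrightarrow> mlin r H \<Longrightarrow> mlin (Suc r) (\<lambda>k. G k * 3 ^ k r + H k)"
  by auto

lemma mlin_const: "mlin r (\<lambda>_. c)"
proof (induction r arbitrary: c)
  case (Suc r)
  show ?case using mlin_SucI[OF Suc[of 0] Suc[of c]] by simp
qed auto

lemma mlin_scale: "mlin r F \<Longrightarrow> mlin r (\<lambda>k. c * F k)"
proof (induction r arbitrary: F)
  case (Suc r)
  then obtain G H where *: "mlin r G" "mlin r H" "F = (\<lambda>k. G k * 3 ^ k r + H k)" by auto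
  show ?case using mlin_SucI[OF Suc.IH[OF *(1)] Suc.IH[OF *(2)]]
    by (simp only: *(3) distrib_left mult.assoc)
qed auto

lemma mlin_add: "mlin r F \<Longrightarrow> mlin r F' \<Longrightarrow> mlin r (\<lambda>k. F k + F' k)"
proof (induction r arbitrary: F F')
  case (Suc r)
  from Suc.prems obtain G H G' H' where
    *: "mlin r G" "mlin r H" "F = (\<lambda>k. G k * 3 ^ k r + H k)"
    "mlin r G'" "mlin r H'" "F' = (\<lambda>k. G' k * 3 ^ k r + H' k)" by auto
  show ?case using mlin_SucI[OF Suc.IH[OF *(1,4)] Suc.IH[OF *(2,5)]]
    by (simp only: *(3,6) distrib_right add_ac)
qed auto

lemma mlin_cong: "mlin r F \<Longrightarrow> (\<And>i. i < r \<Longrightarrow> k i = k' i) \<Longrightarrow> F k = F k'"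
proof (induction r arbitrary: F)
  case (Suc r)
  then obtain G H where *: "mlin r G" "mlin r H" "F = (\<lambda>k. G k * 3 ^ k r + H k)" by auto
  then show ?case using Suc.IH[of G] Suc.IH[of H] Suc.prems(2) by simp
qed auto

text \<open>A product of multilinear functions stays multilinear when the factors share no variable;
  shifting the indices of \<open>G\<close> by \<open>r\<close> ensures this.\<close>

lemma mlin_mult_shift:
  "mlin r F \<Longrightarrow> mlin q G \<Longrightarrow> mlin (r + q) (\<lambda>k. F k * G (\<lambda>i. k (i + r)))"
proof (induction q arbitrary: G)
  case 0
  then obtain c where "G = (\<lambda>_. c)" by auto
  then show ?case using mlin_scale[OF 0(1), of c] by (simp add: mult.commute)
next
  case (Suc q)
  then obtain G1 G2 where *: "mlin q G1" "mlin q G2" "G = (\<lambda>k. G1 k * 3 ^ k q + G2 k)" by auto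
  show ?case
    using mlin_SucI[OF Suc.IH[OF Suc.prems(1) *(1)] Suc.IH[OF Suc.prems(1) *(2)]]
    by (simp only: *(3) add_Suc_right distrib_left mult.assoc add.commute[of q r])
qed

text \<open>A fixed coordinate keeps its index, so substitution does not renumber the variables and
  \<open>r\<close> is unchanged.\<close>

definition fix_coords :: "(nat \<rightharpoonup> nat) \<Rightarrow> (nat \<Rightarrow> nat) \<Rightarrow> nat \<Rightarrow> nat" where
  "fix_coords \<sigma> k i = (case \<sigma> i of None \<Rightarrow> k i | Some c \<Rightarrow> c)"

lemma mlin_fix_coords: "mlin r F \<Longrightarrow> mlin r (\<lambda>k. F (fix_coords \<sigma> k))"
proof (induction r arbitrary: F)
  case (Suc r)
  then obtain G H where *: "mlin r G" "mlin r H" "F = (\<lambda>k. G k * 3 ^ k r + H k)" by auto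
  have G: "mlin r (\<lambda>k. G (fix_coords \<sigma> k))" and H: "mlin r (\<lambda>k. H (fix_coords \<sigma> k))"
    using Suc.IH * by auto
  show ?case
  proof (cases "\<sigma> r")
    case None
    then have "(\<lambda>k. F (fix_coords \<sigma> k)) =
        (\<lambda>k. G (fix_coords \<sigma> k) * 3 ^ k r + H (fix_coords \<sigma> k))"
      by (simp add: * fix_coords_def)
    then show ?thesis using mlin_SucI[OF G H] by (simp only:)
  next
    case (Some c)
    \<comment> \<open>The variable disappears: its coefficient becomes 0, and its former term is a
      constant multiple of the function of the earlier coordinates.\<close>
    then have "(\<lambda>k. F (fix_coords \<sigma> k)) =
        (\<lambda>k. 0 * 3 ^ k r + (3 ^ c * G (fix_coords \<sigma> k) + H (fix_coords \<sigma> k)))"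
      by (simp add: * fix_coords_def mult.commute)
    then show ?thesis
      using mlin_SucI[OF mlin_const[of r 0] mlin_add[OF mlin_scale[OF G, of "3 ^ c"] H]]
      by (simp only:)
  qed
qed auto

section \<open>Realization by multilinear polynomials\<close>

lemma mpoly_eval_superset:
  assumes "finite S" "Poly_Mapping.keys f \<subseteq> S"
  shows "mpoly_eval f x = (\<Sum>m\<in>S. Poly_Mapping.lookup f m *
    (\<Prod>i\<in>Poly_Mapping.keys m. x i ^ Poly_Mapping.lookup m i))"
  unfolding mpoly_eval_def using assms
  by (intro sum.mono_neutral_left) (auto simp: in_keys_iff)

lemma mpoly_eval_add: "mpoly_eval (f + g) x = mpoly_eval f x + mpoly_eval g x"
proof -
  let ?S = "Poly_Mapping.keys f \<union> Poly_Mapping.keys g"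
  have "Poly_Mapping.keys (f + g) \<subseteq> ?S" by (rule Poly_Mapping.keys_add)
  then show ?thesis
    by (simp add: mpoly_eval_superset[of ?S] lookup_add distrib_right sum.distrib)
qed

text \<open>The extra factor \<open>\<Prod>i\<in>A. 3 ^ k i\<close> collects the variables split off by the recursion of \<^const>\<open>mlin\<close>.\<close>

lemma mlin_imp_mpoly_aux:
  assumes "mlin r F" "finite A" "A \<inter> {..<r} = {}"
  shows "\<exists>f :: int mpoly. mpoly_vars f \<subseteq> {..<r} \<union> A \<and> multilinear f \<and>
    (\<forall>k. mpoly_eval f (\<lambda>i. 3 ^ k i) = F k * (\<Prod>i\<in>A. 3 ^ k i))"
  using assms
proof (induction r arbitrary: F A)
  case 0
  then obtain c where c: "F = (\<lambda>_. c)" by auto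
  \<comment> \<open>The squarefree monomial whose variables are exactly those with index in
    \<open>A\<close>.\<close>
  define m :: "nat \<Rightarrow>\<^sub>0 nat" where "m = (\<Sum>i\<in>A. Poly_Mapping.single i 1)"
  have lookup_m: "Poly_Mapping.lookup m i = (if i \<in> A then 1 else 0)" for i
    using 0 by (simp add: m_def lookup_sum lookup_single when_def)
  have keys_m: "Poly_Mapping.keys m = A"
    by (auto simp: in_keys_iff lookup_m split: if_splits)
  show ?case
  proof (intro exI[of _ "Poly_Mapping.single m c"] conjI allI)
    show "mpoly_vars (Poly_Mapping.single m c) \<subseteq> {..<0} \<union> A"
      by (auto simp: mpoly_vars_def keys_m)
    show "multilinear (Poly_Mapping.single m c)"
      by (auto simp: multilinear_def lookup_m)
    show "mpoly_eval (Poly_Mapping.single m c) (\<lambda>i. 3 ^ k i) = F k * (\<Prod>i\<in>A. 3 ^ k i)" for k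
      \<comment> \<open>For \<open>c = 0\<close> the polynomial has no monomials, so its keys are in
        general only a subset of \<open>{m}\<close>.\<close>
      by (subst mpoly_eval_superset[of "{m}"]) (auto simp: keys_m lookup_m c)
  qed
next
  case (Suc r)
  then obtain G H where *: "mlin r G" "mlin r H" "F = (\<lambda>k. G k * 3 ^ k r + H k)" by auto
  have r: "r \<notin> A" "A \<inter> {..<r} = {}" using Suc.prems(3) by auto
  \<comment> \<open>The factor \<open>3 ^ k r\<close> is moved into the product over
    \<open>insert r A\<close>; since \<open>r \<notin> A\<close>, no exponent reaches 2.\<close>
  obtain g :: "int mpoly" where g: "mpoly_vars g \<subseteq> {..<r} \<union> insert r A" "multilinear g"
    "\<forall>k. mpoly_eval g (\<lambda>i. 3 ^ k i) = G k * (\<Prod>i\<in>insert r A. 3 ^ k i)"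
    using Suc.IH[OF *(1), of "insert r A"] Suc.prems(2) r by auto
  obtain h :: "int mpoly" where h: "mpoly_vars h \<subseteq> {..<r} \<union> A" "multilinear h"
    "\<forall>k. mpoly_eval h (\<lambda>i. 3 ^ k i) = H k * (\<Prod>i\<in>A. 3 ^ k i)"
    using Suc.IH[OF *(2), of A] Suc.prems(2) r by auto
  have keys: "Poly_Mapping.keys (g + h) \<subseteq> Poly_Mapping.keys g \<union> Poly_Mapping.keys h"
    by (rule Poly_Mapping.keys_add)
  show ?case
  proof (intro exI[of _ "g + h"] conjI allI)
    have "mpoly_vars (g + h) \<subseteq> mpoly_vars g \<union> mpoly_vars h"
      using keys by (auto simp: mpoly_vars_def)
    also have "\<dots> \<subseteq> {..<Suc r} \<union> A" using g(1) h(1) by auto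
    finally show "mpoly_vars (g + h) \<subseteq> {..<Suc r} \<union> A" .
    show "multilinear (g + h)" using g(2) h(2) keys unfolding multilinear_def by blast
    show "mpoly_eval (g + h) (\<lambda>i. 3 ^ k i) = F k * (\<Prod>i\<in>A. 3 ^ k i)" for k
      using g(3) h(3) r Suc.prems(2) by (simp add: mpoly_eval_add * algebra_simps)
  qed
qed

lemma mlin_imp_mpoly:
  assumes "mlin r F"
  shows "\<exists>f :: int mpoly. mpoly_vars f \<subseteq> {..<r} \<and> multilinear f \<and>
    (\<forall>k. mpoly_eval f (\<lambda>i. 3 ^ k i) = F k)"
  using mlin_imp_mpoly_aux[OF assms, of "{}"] by auto

section \<open>Downward closed sets of exponents\<close>

text \<open>A partial map stands for the set of all its total extensions. A point \<open>p\<close>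
  outside \<open>D\<close> forces every \<open>k \<in> D\<close> to satisfy \<open>k i < p i\<close>
  for some \<open>i \<in> V\<close>. So finitely many slices \<open>k i = c\<close> cover
  \<open>D\<close>, and each is downward closed in the remaining coordinates, which allows induction
  on \<open>V\<close>.\<close>

lemma downward_closed_finite_union:
  fixes D :: "('a \<Rightarrow> nat) set"
  assumes "finite V" "\<And>k k'. k \<in> D \<Longrightarrow> (\<And>i. i \<in> V \<Longrightarrow> k' i \<le> k i) \<Longrightarrow> k' \<in> D"
  shows "\<exists>X. finite X \<and> (\<forall>\<sigma>\<in>X. dom \<sigma> \<subseteq> V) \<and>
    (\<forall>k. k \<in> D \<longleftrightarrow> (\<exists>\<sigma>\<in>X. \<sigma> \<subseteq>\<^sub>m (\<lambda>i. Some (k i))))"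
  using assms
proof (induction V arbitrary: D rule: finite_psubset_induct)
  case (psubset V)
  show ?case
  proof (cases "D = UNIV")
    case True
    then show ?thesis by (intro exI[of _ "{Map.empty}"]) auto
  next
    case False
    then obtain p where p: "p \<notin> D" by auto
    have ex: "\<exists>i\<in>V. k i < p i" if "k \<in> D" for k
    proof (rule ccontr)
      assume "\<not> (\<exists>i\<in>V. k i < p i)"
      then have "p \<in> D" by (intro psubset.prems[OF that]) (auto simp: not_less)
      then show False using p by simp
    qed
    \<comment> \<open>Overwriting coordinate \<open>i\<close> turns the slice into a cylinder, where
      membership depends only on \<open>V - {i}\<close>.\<close>
    define E where "E = (\<lambda>(i, c). {k. k(i := c) \<in> D})"
    define J where "J = (SIGMA i:V. {..<p i})"
    define Q where "Q ic X \<longleftrightarrow> finite X \<and> (\<forall>\<sigma>\<in>X. dom \<sigma> \<subseteq> V - {fst ic}) \<and>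
      (\<forall>k. k \<in> E ic \<longleftrightarrow> (\<exists>\<sigma>\<in>X. \<sigma> \<subseteq>\<^sub>m (\<lambda>i. Some (k i))))" for ic X
    have "\<exists>X. Q ic X" if "ic \<in> J" for ic
    proof -
      obtain i c where ic: "ic = (i, c)" by (cases ic)
      have "i \<in> V" using that by (simp add: J_def ic)
      then have sub: "V - {fst ic} \<subset> V" unfolding ic fst_conv by blast
      have down: "k' \<in> E ic" if k: "k \<in> E ic" and le: "\<And>i. i \<in> V - {fst ic} \<Longrightarrow> k' i \<le> k i" for k k'
      proof -
        have "k(i := c) \<in> D" using k by (simp add: E_def ic)
        then have "k'(i := c) \<in> D"
        proof (rule psubset.prems)
          show "(k'(i := c)) j \<le> (k(i := c)) j" if "j \<in> V" for j
            using le[of j] that by (cases "j = i") (simp_all add: ic)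
        qed
        then show ?thesis by (simp add: E_def ic)
      qed
      show ?thesis unfolding Q_def by (rule psubset.IH[OF sub down])
    qed
    then obtain X where "\<And>ic. ic \<in> J \<Longrightarrow> Q ic (X ic)" by metis
    then have X: "\<And>ic. ic \<in> J \<Longrightarrow> finite (X ic)"
      "\<And>ic \<sigma>. ic \<in> J \<Longrightarrow> \<sigma> \<in> X ic \<Longrightarrow> dom \<sigma> \<subseteq> V - {fst ic}"
      "\<And>ic k. ic \<in> J \<Longrightarrow> k \<in> E ic \<longleftrightarrow> (\<exists>\<sigma>\<in>X ic. \<sigma> \<subseteq>\<^sub>m (\<lambda>i. Some (k i)))"
      unfolding Q_def by simp_all
    define Y where "Y = (\<Union>ic\<in>J. (\<lambda>\<sigma>. \<sigma>(fst ic \<mapsto> snd ic)) ` X ic)"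
    have "finite J" using psubset.hyps by (auto simp: J_def)
    show ?thesis
    proof (intro exI[of _ Y] conjI allI ballI)
      show "finite Y" using \<open>finite J\<close> X(1) by (auto simp: Y_def)
      show "dom \<sigma> \<subseteq> V" if \<sigma>: "\<sigma> \<in> Y" for \<sigma>
      proof -
        obtain i c \<tau> where "(i, c) \<in> J" "\<tau> \<in> X (i, c)" "\<sigma> = \<tau>(i \<mapsto> c)"
          using \<sigma> by (auto simp: Y_def)
        then show ?thesis using X(2)[of "(i, c)" \<tau>] by (auto simp: J_def)
      qed
      fix k
      show "k \<in> D \<longleftrightarrow> (\<exists>\<sigma>\<in>Y. \<sigma> \<subseteq>\<^sub>m (\<lambda>i. Some (k i)))"
      proof
        assume "k \<in> D"
        then obtain i where i: "i \<in> V" "k i < p i" using ex by blast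
        then have J: "(i, k i) \<in> J" by (simp add: J_def)
        have "k \<in> E (i, k i)" using \<open>k \<in> D\<close> by (simp add: E_def)
        then obtain \<sigma> where \<sigma>: "\<sigma> \<in> X (i, k i)" "\<sigma> \<subseteq>\<^sub>m (\<lambda>i. Some (k i))" using X(3)[OF J] by blast
        then have "\<sigma>(i \<mapsto> k i) \<subseteq>\<^sub>m (\<lambda>i. Some (k i))" by (auto simp: map_le_def)
        moreover have "\<sigma>(i \<mapsto> k i) \<in> Y"
          unfolding Y_def using J \<sigma>(1) by (intro UN_I[of "(i, k i)"]) auto
        ultimately show "\<exists>\<sigma>\<in>Y. \<sigma> \<subseteq>\<^sub>m (\<lambda>i. Some (k i))" by blast
      next
        assume "\<exists>\<sigma>\<in>Y. \<sigma> \<subseteq>\<^sub>m (\<lambda>i. Some (k i))"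
        then obtain i c \<sigma> where \<sigma>: "(i, c) \<in> J" "\<sigma> \<in> X (i, c)"
          "\<sigma>(i \<mapsto> c) \<subseteq>\<^sub>m (\<lambda>i. Some (k i))" by (auto simp: Y_def)
        have "k i = c" using \<sigma>(3) by (auto simp: map_le_def)
        \<comment> \<open>The update therefore adds a constraint to \<open>\<sigma>\<close> and
          overwrites none.\<close>
        have "i \<notin> dom \<sigma>" using X(2)[OF \<sigma>(1,2)] by auto
        then have "\<sigma> \<subseteq>\<^sub>m (\<lambda>i. Some (k i))"
          using \<sigma>(3) by (auto simp: map_le_def dom_def split: if_splits)
        then have "k \<in> E (i, c)" using X(3)[OF \<sigma>(1)] \<sigma>(2) by blast
        then show "k \<in> D" using \<open>k i = c\<close> by (auto simp: E_def)
      qed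
    qed
  qed
qed

section \<open>Covering numbers of small defect by families\<close>

type_synonym family = "nat \<times> ((nat \<Rightarrow> nat) \<Rightarrow> nat) \<times> nat"

text \<open>The last clause, with denominators cleared, says that
  \<open>F k / 3 ^ (\<Sum>i<r. k i)\<close> is antitone in the first \<open>r\<close> exponents.
  Equivalently, the defect bound \<open>C + 3 * (\<Sum>i<r. k i) - 3 * log 3 (F k)\<close> is
  monotone.\<close>

definition low_defect_family :: "family \<Rightarrow> bool" where
  "low_defect_family = (\<lambda>(r, F, C). mlin r (\<lambda>k. int (F k)) \<and>
    (\<forall>k. 0 < F k \<and> complexity (F k) \<le> C + 3 * (\<Sum>i<r. k i)) \<and>
    (\<forall>k k'. (\<forall>i<r. k i \<le> k' i) \<longrightarrow> F k' * 3 ^ (\<Sum>i<r. k i) \<le> F k * 3 ^ (\<Sum>i<r. k' i)))"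

text \<open>Equality of the costs makes the defect of \<open>n\<close> coincide with the family's
  bound at \<open>k\<close>.\<close>

definition represents :: "family \<Rightarrow> nat \<Rightarrow> bool" where
  "represents = (\<lambda>(r, F, C) n. \<exists>k. n = F k \<and> complexity n = C + 3 * (\<Sum>i<r. k i))"

section \<open>Operations on families\<close>

definition const_family :: "nat \<Rightarrow> family" where
  "const_family c = (0, \<lambda>_. c, complexity c)"

definition pow3_family :: "family \<Rightarrow> family" where
  "pow3_family = (\<lambda>(r, F, C). (Suc r, \<lambda>k. F k * 3 ^ k r, C))"

definition add_family :: "nat \<Rightarrow> family \<Rightarrow> family" where
  "add_family b = (\<lambda>(r, F, C). (r, \<lambda>k. F k + b, C + complexity b))"

definition mult_family :: "family \<Rightarrow> family \<Rightarrow> family" where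
  "mult_family = (\<lambda>(r, F, C) (q, G, B). (r + q, \<lambda>k. F k * G (\<lambda>i. k (i + r)), C + B))"

lemma low_defect_const: "0 < c \<Longrightarrow> low_defect_family (const_family c)"
  using mlin_const[of 0 "int c"] by (simp only: low_defect_family_def const_family_def) simp

lemma represents_const: "represents (const_family c) c"
  by (simp add: represents_def const_family_def)

lemma low_defect_pow3:
  assumes "low_defect_family f"
  shows "low_defect_family (pow3_family f)"
proof -
  obtain r F C where f: "f = (r, F, C)" by (cases f)
  have F: "mlin r (\<lambda>k. int (F k))" "\<And>k. 0 < F k"
    "\<And>k. complexity (F k) \<le> C + 3 * (\<Sum>i<r. k i)"
    "\<And>k k'. (\<forall>i<r. k i \<le> k' i) \<Longrightarrow> F k' * 3 ^ (\<Sum>i<r. k i) \<le> F k * 3 ^ (\<Sum>i<r. k' i)"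
    using assms by (auto simp: f low_defect_family_def)
  have "mlin (Suc r) (\<lambda>k. int (F k * 3 ^ k r))"
    using mlin_SucI[OF F(1) mlin_const[of r 0]] by simp
  moreover have "complexity (F k * 3 ^ k r) \<le> C + 3 * (\<Sum>i<Suc r. k i)" for k
    using complexity_mult_pow3[OF F(2), of k "k r"] F(3)[of k] by simp
  moreover have "F k' * 3 ^ k' r * 3 ^ (\<Sum>i<Suc r. k i) \<le> F k * 3 ^ k r * 3 ^ (\<Sum>i<Suc r. k' i)"
    if "\<forall>i<Suc r. k i \<le> k' i" for k k'
  proof -
    have "F k' * 3 ^ (\<Sum>i<r. k i) * 3 ^ (k r + k' r) \<le> F k * 3 ^ (\<Sum>i<r. k' i) * 3 ^ (k r + k' r)"
      using F(4)[of k k'] that by (intro mult_right_mono) auto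
    then show ?thesis by (simp add: power_add mult_ac)
  qed
  ultimately show ?thesis using F(2) by (simp only: f low_defect_family_def pow3_family_def) simp
qed

lemma represents_pow3:
  assumes "low_defect_family f" "represents f u" "complexity (u * 3 ^ j) = complexity u + 3 * j"
  shows "represents (pow3_family f) (u * 3 ^ j)"
proof -
  obtain r F C where f: "f = (r, F, C)" by (cases f)
  obtain k where k: "u = F k" "complexity u = C + 3 * (\<Sum>i<r. k i)"
    using assms(2) by (auto simp: f represents_def)
  have "mlin r (\<lambda>k. int (F k))" using assms(1) by (simp add: f low_defect_family_def)
  \<comment> \<open>Coordinate \<open>r\<close> is free to carry the exponent \<open>j\<close>,
    since \<open>F\<close> reads only the coordinates below \<open>r\<close>.\<close>
  then have "int (F (k(r := j))) = int (F k)" by (rule mlin_cong) auto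
  then show ?thesis using assms(3) k
    by (auto simp: f represents_def pow3_family_def intro!: exI[of _ "k(r := j)"])
qed

lemma low_defect_add:
  assumes "low_defect_family f" "0 < b"
  shows "low_defect_family (add_family b f)"
proof -
  obtain r F C where f: "f = (r, F, C)" by (cases f)
  have F: "mlin r (\<lambda>k. int (F k))" "\<And>k. 0 < F k"
    "\<And>k. complexity (F k) \<le> C + 3 * (\<Sum>i<r. k i)"
    "\<And>k k'. (\<forall>i<r. k i \<le> k' i) \<Longrightarrow> F k' * 3 ^ (\<Sum>i<r. k i) \<le> F k * 3 ^ (\<Sum>i<r. k' i)"
    using assms by (auto simp: f low_defect_family_def)
  have "mlin r (\<lambda>k. int (F k + b))"
    using mlin_add[OF F(1) mlin_const[of r "int b"]] by simp
  moreover have "complexity (F k + b) \<le> C + complexity b + 3 * (\<Sum>i<r. k i)" for k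
    using complexity_add[OF F(2) assms(2), of k] F(3)[of k] by simp
  moreover have "(F k' + b) * 3 ^ (\<Sum>i<r. k i) \<le> (F k + b) * 3 ^ (\<Sum>i<r. k' i)"
    if "\<forall>i<r. k i \<le> k' i" for k k'
  proof -
    \<comment> \<open>The added constant, divided by the power of 3, is itself antitone.\<close>
    have "(3::nat) ^ (\<Sum>i<r. k i) \<le> 3 ^ (\<Sum>i<r. k' i)"
      using that by (intro power_increasing sum_mono) auto
    then show ?thesis using F(4)[OF that] by (simp add: distrib_right add_mono)
  qed
  ultimately show ?thesis using F(2) by (simp add: f low_defect_family_def add_family_def)
qed

lemma represents_add:
  assumes "represents f a" "complexity (a + b) = complexity a + complexity b"
  shows "represents (add_family b f) (a + b)"
  using assms by (force simp: represents_def add_family_def split: prod.splits)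

lemma sum_split_shift:
  fixes k :: "nat \<Rightarrow> nat"
  shows "(\<Sum>i<r + q. k i) = (\<Sum>i<r. k i) + (\<Sum>i<q. k (i + r))"
  by (induction q) (simp_all add: add_ac)

lemma low_defect_mult:
  assumes "low_defect_family f" "low_defect_family g"
  shows "low_defect_family (mult_family f g)"
proof -
  obtain r F C where f: "f = (r, F, C)" by (cases f)
  obtain q G B where g: "g = (q, G, B)" by (cases g)
  have F: "mlin r (\<lambda>k. int (F k))" "\<And>k. 0 < F k"
    "\<And>k. complexity (F k) \<le> C + 3 * (\<Sum>i<r. k i)"
    "\<And>k k'. (\<forall>i<r. k i \<le> k' i) \<Longrightarrow> F k' * 3 ^ (\<Sum>i<r. k i) \<le> F k * 3 ^ (\<Sum>i<r. k' i)"
    using assms by (auto simp: f low_defect_family_def)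
  have G: "mlin q (\<lambda>k. int (G k))" "\<And>k. 0 < G k"
    "\<And>k. complexity (G k) \<le> B + 3 * (\<Sum>i<q. k i)"
    "\<And>k k'. (\<forall>i<q. k i \<le> k' i) \<Longrightarrow> G k' * 3 ^ (\<Sum>i<q. k i) \<le> G k * 3 ^ (\<Sum>i<q. k' i)"
    using assms by (auto simp: g low_defect_family_def)
  have "mlin (r + q) (\<lambda>k. int (F k * G (\<lambda>i. k (i + r))))"
    using mlin_mult_shift[OF F(1) G(1)] by simp
  moreover have "complexity (F k * G (\<lambda>i. k (i + r))) \<le> C + B + 3 * (\<Sum>i<r + q. k i)" for k
    using complexity_mult[OF F(2) G(2), of k "\<lambda>i. k (i + r)"] F(3)[of k] G(3)[of "\<lambda>i. k (i + r)"]
    by (simp add: sum_split_shift)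
  moreover have "F k' * G (\<lambda>i. k' (i + r)) * 3 ^ (\<Sum>i<r + q. k i)
      \<le> F k * G (\<lambda>i. k (i + r)) * 3 ^ (\<Sum>i<r + q. k' i)"
    if "\<forall>i<r + q. k i \<le> k' i" for k k'
  proof -
    have "(F k' * 3 ^ (\<Sum>i<r. k i)) * (G (\<lambda>i. k' (i + r)) * 3 ^ (\<Sum>i<q. k (i + r)))
        \<le> (F k * 3 ^ (\<Sum>i<r. k' i)) * (G (\<lambda>i. k (i + r)) * 3 ^ (\<Sum>i<q. k' (i + r)))"
      using that by (intro mult_mono F(4) G(4)) auto
    then show ?thesis by (simp add: sum_split_shift power_add mult_ac)
  qed
  ultimately show ?thesis using F(2) G(2)
    by (simp only: f g low_defect_family_def mult_family_def) simp
qed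

lemma represents_mult:
  assumes "low_defect_family f" "represents f u" "represents g v"
    "complexity (u * v) = complexity u + complexity v"
  shows "represents (mult_family f g) (u * v)"
proof -
  obtain r F C where f: "f = (r, F, C)" by (cases f)
  obtain q G B where g: "g = (q, G, B)" by (cases g)
  obtain k where k: "u = F k" "complexity u = C + 3 * (\<Sum>i<r. k i)"
    using assms(2) by (auto simp: f represents_def)
  obtain l where l: "v = G l" "complexity v = B + 3 * (\<Sum>i<q. l i)"
    using assms(3) by (auto simp: g represents_def)
  \<comment> \<open>The two exponent vectors are concatenated.\<close>
  define h where "h i = (if i < r then k i else l (i - r))" for i
  have "mlin r (\<lambda>k. int (F k))" using assms(1) by (simp add: f low_defect_family_def)
  then have "int (F h) = int (F k)" by (rule mlin_cong) (simp add: h_def)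
  then have "F h = F k" by simp
  moreover have "(\<lambda>i. h (i + r)) = l" by (simp add: h_def)
  moreover have "(\<Sum>i<r. h i) = (\<Sum>i<r. k i)" by (simp add: h_def)
  ultimately show ?thesis using assms(4) k l
    by (auto simp: f g represents_def mult_family_def sum_split_shift intro!: exI[of _ h])
qed

section \<open>Existence of finite coverings\<close>

definition covers :: "family set \<Rightarrow> real \<Rightarrow> bool" where
  "covers S t \<longleftrightarrow> finite S \<and> (\<forall>f\<in>S. low_defect_family f) \<and>
    (\<forall>n>0. defect n < t \<longrightarrow> (\<exists>f\<in>S. represents f n))"

lemma finite_complexity_le: "finite {b. 0 < b \<and> real (complexity b) \<le> x}"
proof (rule finite_subset)
  show "{b. 0 < b \<and> real (complexity b) \<le> x} \<subseteq> {..3 ^ nat \<lfloor>x\<rfloor>}"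
  proof clarsimp
    fix b assume b: "0 < b" "real (complexity b) \<le> x"
    have "b \<le> b ^ 3" using b by (intro self_le_power) auto
    also have "\<dots> \<le> 3 ^ complexity b" using b by (intro cube_le_complexity)
    also have "\<dots> \<le> 3 ^ nat \<lfloor>x\<rfloor>" using b by (intro power_increasing) (auto simp: le_nat_floor)
    finally show "b \<le> 3 ^ nat \<lfloor>x\<rfloor>" .
  qed
qed simp

lemma covers_step:
  assumes "covers S t"
  shows "\<exists>S'. covers S' (t + 1 / 10)"
proof -
  have S: "finite S" "\<And>f. f \<in> S \<Longrightarrow> low_defect_family f"
    "\<And>n. 0 < n \<Longrightarrow> defect n < t \<Longrightarrow> \<exists>f\<in>S. represents f n"
    using assms by (auto simp: covers_def)
  \<comment> \<open>Smaller summands have complexity at most \<open>defect n + 2\<close>, which is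
    less than \<open>t + 3\<close>.\<close>
  define B where "B = {b. 0 < b \<and> real (complexity b) \<le> t + 3}"
  define U where "U = const_family ` {1..5} \<union> (\<lambda>(b, f). add_family b f) ` (B \<times> S)
    \<union> (\<lambda>(f, g). mult_family f g) ` (S \<times> S)"
  have finU: "finite U" using S(1) finite_complexity_le[of "t + 3"] by (simp add: U_def B_def)
  have lowU: "low_defect_family f" if "f \<in> U" for f
    using that unfolding U_def B_def
    by (auto intro: S(2) low_defect_const low_defect_add low_defect_mult)
  \<comment> \<open>All powers of 3 are collected before \<open>pow3_family\<close> is applied once.
    Adjoining a new variable for each such factor would give no finite bound on the number of
    families.\<close>
  have strip: "\<exists>j u. n = u * 3 ^ j \<and> complexity n = complexity u + 3 * j \<and> (\<exists>f\<in>U. represents f u)"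
    if "0 < n" "defect n < t + 1 / 10" for n
    using that
  proof (induction n rule: less_induct)
    case (less n)
    have pow3_factor: ?case if n: "n = a * b" "1 < a" "1 < b" "complexity n = complexity a + complexity b"
      and b: "defect b < 1 / 10" for a b
    proof -
      have d: "defect n = defect a + defect b" using n defect_mult[of a b] by simp
      have "0 \<le> defect b" using n by (intro defect_nonneg) auto
      then obtain j u where u: "a = u * 3 ^ j" "complexity a = complexity u + 3 * j"
        "\<exists>f\<in>U. represents f u"
        using less.IH[of a] n d less.prems by auto
      obtain i where i: "b = 3 ^ i" using defect_lt_imp_pow3[of b] n b by auto
      then have "i > 0" using n by (cases i) auto
      then have "complexity b = 3 * i" using complexity_pow3 i by simp
      then have "n = u * 3 ^ (j + i) \<and> complexity n = complexity u + 3 * (j + i)"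
        using n u i by (simp add: power_add)
      then show ?thesis using u(3) by blast
    qed
    have no_power: ?case if "\<exists>f\<in>U. represents f n"
      using that by (intro exI[of _ 0] exI[of _ n]) simp
    show ?case
    proof (cases "n \<le> 5")
      case True
      then have "const_family n \<in> U" using less.prems(1) by (simp add: U_def)
      then show ?thesis using no_power represents_const by blast
    next
      case False
      then have "n \<ge> 2" by simp
      then show ?thesis
      proof (cases rule: complexity_cases)
        case (sum a b)
        \<comment> \<open>As 1/2 > 1/10, the larger summand has defect below \<open>t\<close> and is
          covered by \<open>S\<close>.\<close>
        have "defect a + 1 / 2 \<le> defect n" using sum False defect_sum_ge[of b a] by simp
        then obtain f where f: "f \<in> S" "represents f a" using S(3)[of a] sum less.prems by auto
        have "b \<in> B" using complexity_summand_le[of b a] sum less.prems by (simp add: B_def)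
        then have "add_family b f \<in> U"
          using image_eqI[of _ "\<lambda>(b, f). add_family b f" "(b, f)" "B \<times> S"] f by (simp add: U_def)
        moreover have "represents (add_family b f) n" using represents_add f sum by simp
        ultimately show ?thesis using no_power by blast
      next
        case (product a b)
        have d: "defect n = defect a + defect b" using product defect_mult[of a b] by simp
        show ?thesis
        proof (cases "defect a < 1 / 10 \<or> defect b < 1 / 10")
          case True
          have "n = b * a" "complexity n = complexity b + complexity a" using product by simp_all
          then show ?thesis using True pow3_factor[of a b] pow3_factor[of b a] product by blast
        next
          case False
          \<comment> \<open>Each factor uses at least 1/10 of the defect, so the other one stays
            below \<open>t\<close>.\<close>
          obtain f where f: "f \<in> S" "represents f a"
            using S(3)[of a] product d False less.prems by auto
          obtain g where g: "g \<in> S" "represents g b"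
            using S(3)[of b] product d False less.prems by auto
          have "mult_family f g \<in> U"
            using image_eqI[of _ "\<lambda>(f, g). mult_family f g" "(f, g)" "S \<times> S"] f g by (simp add: U_def)
          moreover have "represents (mult_family f g) n"
            using represents_mult f g product S(2) by simp
          ultimately show ?thesis using no_power by blast
        qed
      qed
    qed
  qed
  have "\<exists>f\<in>pow3_family ` U. represents f n" if n: "0 < n" "defect n < t + 1 / 10" for n
  proof -
    obtain j u f where "n = u * 3 ^ j" "complexity n = complexity u + 3 * j" "f \<in> U" "represents f u"
      using strip[OF n] by blast
    then show ?thesis using represents_pow3[OF lowU, of f u j] by blast
  qed
  then have "covers (pow3_family ` U) (t + 1 / 10)"
    unfolding covers_def using finU lowU low_defect_pow3 by auto
  then show ?thesis by blast
qed

text \<open>No positive number has negative defect, so the empty set covers the bound 0; steps of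
  1/10 reach a multiple of 1/10 that is at least \<open>t\<close>, and a covering serves every
  smaller bound.\<close>

lemma ex_covers: "\<exists>S. covers S t"
proof -
  have *: "\<exists>S. covers S (real N / 10)" for N
  proof (induction N)
    case 0
    have "covers {} 0" unfolding covers_def using defect_nonneg by (simp add: not_less)
    then show ?case by (auto intro: exI[of _ "{}"])
  next
    case (Suc N)
    then obtain S where "covers S (real N / 10)" by blast
    from covers_step[OF this] show ?case by (simp add: add_divide_distrib add.commute)
  qed
  obtain N where "10 * t \<le> real N" using real_arch_simple by blast
  moreover obtain S where "covers S (real N / 10)" using * by blast
  ultimately have "covers S t" by (auto simp: covers_def)
  then show ?thesis by blast
qed

section \<open>Truncating the families\<close>

text \<open>The selection uses the family's bound rather than the defect itself. The bound dominates
  the defect, so nothing of defect \<open>s\<close> or more is kept; it equals the defect for a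
  represented number, so none below \<open>s\<close> is lost.\<close>

lemma low_defect_family_truncate:
  assumes "low_defect_family (r, F, C)"
  shows "\<exists>T :: (nat \<times> int mpoly) set. finite T \<and>
    (\<forall>(q, f)\<in>T. q = r \<and> mpoly_vars f \<subseteq> {..<r} \<and> multilinear f) \<and>
    (\<forall>n. (\<exists>(q, f)\<in>T. \<exists>k. n = mpoly_eval f (\<lambda>i. 3 ^ k i)) \<longleftrightarrow>
      (\<exists>k. n = int (F k) \<and> real C + 3 * real (\<Sum>i<r. k i) - 3 * log 3 (real (F k)) < s))"
proof -
  have F: "mlin r (\<lambda>k. int (F k))" "\<And>k. 0 < F k"
    "\<And>k k'. (\<forall>i<r. k i \<le> k' i) \<Longrightarrow> F k' * 3 ^ (\<Sum>i<r. k i) \<le> F k * 3 ^ (\<Sum>i<r. k' i)"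
    using assms by (auto simp: low_defect_family_def)
  define d where "d k = real C + 3 * real (\<Sum>i<r. k i) - 3 * log 3 (real (F k))" for k
  have d_mono: "d k \<le> d k'" if "\<forall>i<r. k i \<le> k' i" for k k'
  proof -
    have pos: "0 < real (F k)" "0 < real (F k')" using F(2) by auto
    have "real (F k' * 3 ^ (\<Sum>i<r. k i)) \<le> real (F k * 3 ^ (\<Sum>i<r. k' i))"
      using F(3)[OF that] by (simp only: of_nat_le_iff)
    then have "log 3 (real (F k') * 3 ^ (\<Sum>i<r. k i)) \<le> log 3 (real (F k) * 3 ^ (\<Sum>i<r. k' i))"
      using pos by (subst log_le_cancel_iff) auto
    moreover have "log 3 (real (F k') * 3 ^ (\<Sum>i<r. k i)) = log 3 (real (F k')) + real (\<Sum>i<r. k i)"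
      using pos by (subst log_mult) (auto simp: log_nat_power)
    moreover have "log 3 (real (F k) * 3 ^ (\<Sum>i<r. k' i)) = log 3 (real (F k)) + real (\<Sum>i<r. k' i)"
      using pos by (subst log_mult) (auto simp: log_nat_power)
    ultimately show ?thesis by (simp add: d_def)
  qed
  have "\<exists>X. finite X \<and> (\<forall>\<sigma>\<in>X. dom \<sigma> \<subseteq> {..<r}) \<and>
    (\<forall>k. k \<in> {k. d k < s} \<longleftrightarrow> (\<exists>\<sigma>\<in>X. \<sigma> \<subseteq>\<^sub>m (\<lambda>i. Some (k i))))"
  proof (rule downward_closed_finite_union)
    fix k k' :: "nat \<Rightarrow> nat"
    assume "k \<in> {k. d k < s}" "\<And>i. i \<in> {..<r} \<Longrightarrow> k' i \<le> k i"
    then show "k' \<in> {k. d k < s}" using d_mono[of k' k] by simp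
  qed simp
  then obtain X where X: "finite X" "\<And>k. d k < s \<longleftrightarrow> (\<exists>\<sigma>\<in>X. \<sigma> \<subseteq>\<^sub>m (\<lambda>i. Some (k i)))"
    by auto
  define Q where "Q \<sigma> f \<longleftrightarrow> mpoly_vars f \<subseteq> {..<r} \<and> multilinear f \<and>
    (\<forall>k. mpoly_eval f (\<lambda>i. 3 ^ k i) = int (F (fix_coords \<sigma> k)))" for \<sigma> and f :: "int mpoly"
  have "\<exists>f. Q \<sigma> f" for \<sigma>
    unfolding Q_def by (rule mlin_imp_mpoly[OF mlin_fix_coords[OF F(1)]])
  then obtain p where "\<And>\<sigma>. Q \<sigma> (p \<sigma>)" by metis
  then have p: "\<And>\<sigma>. mpoly_vars (p \<sigma>) \<subseteq> {..<r}"
    "\<And>\<sigma>. multilinear (p \<sigma>)" "\<And>\<sigma> k. mpoly_eval (p \<sigma>) (\<lambda>i. 3 ^ k i) = int (F (fix_coords \<sigma> k))"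
    by (simp_all add: Q_def)
  \<comment> \<open>Every \<open>fix_coords \<sigma> k\<close> extends \<open>\<sigma>\<close>, and
    every extension of \<open>\<sigma>\<close> is a fixed point. Hence the substituted function
    takes exactly the values of \<open>F\<close> on the extensions of
    \<open>\<sigma>\<close>.\<close>
  have fix1: "\<sigma> \<subseteq>\<^sub>m (\<lambda>i. Some (fix_coords \<sigma> k i))" for \<sigma> k
    by (auto simp: map_le_def fix_coords_def)
  have fix2: "fix_coords \<sigma> k = k" if \<sigma>: "\<sigma> \<subseteq>\<^sub>m (\<lambda>i. Some (k i))" for \<sigma> k
  proof
    show "fix_coords \<sigma> k i = k i" for i
      using \<sigma> by (cases "\<sigma> i") (auto simp: map_le_def fix_coords_def dom_def)
  qed
  have "(\<exists>(q, f)\<in>(\<lambda>\<sigma>. (r, p \<sigma>)) ` X. \<exists>k. n = mpoly_eval f (\<lambda>i. 3 ^ k i)) \<longleftrightarrow>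
      (\<exists>k. n = int (F k) \<and> d k < s)" for n
  proof -
    have "(\<exists>(q, f)\<in>(\<lambda>\<sigma>. (r, p \<sigma>)) ` X. \<exists>k. n = mpoly_eval f (\<lambda>i. 3 ^ k i)) \<longleftrightarrow>
      (\<exists>\<sigma>\<in>X. \<exists>k. n = int (F (fix_coords \<sigma> k)))" by (simp add: p(3))
    also have "\<dots> \<longleftrightarrow> (\<exists>k. n = int (F k) \<and> d k < s)"
    proof
      assume "\<exists>\<sigma>\<in>X. \<exists>k. n = int (F (fix_coords \<sigma> k))"
      then show "\<exists>k. n = int (F k) \<and> d k < s" unfolding X(2) using fix1 by blast
    next
      assume "\<exists>k. n = int (F k) \<and> d k < s"
      then obtain k \<sigma> where k: "n = int (F k)" "\<sigma> \<in> X" "\<sigma> \<subseteq>\<^sub>m (\<lambda>i. Some (k i))"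
        unfolding X(2) by blast
      have "n = int (F (fix_coords \<sigma> k))" using k(1) fix2[OF k(3)] by simp
      then show "\<exists>\<sigma>\<in>X. \<exists>k. n = int (F (fix_coords \<sigma> k))" using k(2) by blast
    qed
    finally show ?thesis .
  qed
  then show ?thesis using X(1) p(1,2) unfolding d_def
    by (intro exI[of _ "(\<lambda>\<sigma>. (r, p \<sigma>)) ` X"]) auto
qed

section \<open>Assembling the polynomials\<close>

theorem theorem1p5:
  fixes s :: real
  assumes "s \<ge> 0"
  shows "\<exists>T :: (nat \<times> int mpoly) set.
    finite T \<and>
    (\<forall>(r, f)\<in>T. mpoly_vars f \<subseteq> {..<r} \<and> multilinear f) \<and>
    (\<forall>n>0. defect n < s \<longleftrightarrow>
      (\<exists>(r, f)\<in>T. \<exists>k :: nat \<Rightarrow> nat. int n = mpoly_eval f (\<lambda>i. 3 ^ k i) * 3 ^ k r)) \<and>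
    int ` {n. n > 0 \<and> defect n < s} =
      (\<Union>(r, f)\<in>T. {mpoly_eval f (\<lambda>i. 3 ^ k i) * 3 ^ k r | k :: nat \<Rightarrow> nat. True})"
proof -
  obtain S where S: "finite S" "\<And>g. g \<in> S \<Longrightarrow> low_defect_family g"
    "\<And>n. 0 < n \<Longrightarrow> defect n < s \<Longrightarrow> \<exists>g\<in>S. represents g n"
    using ex_covers[of s] by (auto simp: covers_def)
  define Q where "Q g T \<longleftrightarrow> finite T \<and>
      (\<forall>(q, f)\<in>T. q = fst g \<and> mpoly_vars f \<subseteq> {..<fst g} \<and> multilinear f) \<and>
      (\<forall>n. (\<exists>(q, f)\<in>T. \<exists>k. n = mpoly_eval f (\<lambda>i. 3 ^ k i)) \<longleftrightarrow>
        (\<exists>k. n = int (fst (snd g) k) \<and> real (snd (snd g)) + 3 * real (\<Sum>i<fst g. k i)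
          - 3 * log 3 (real (fst (snd g) k)) < s))"
    for g :: family and T :: "(nat \<times> int mpoly) set"
  have "\<exists>T. Q g T" if "g \<in> S" for g
    unfolding Q_def by (rule low_defect_family_truncate) (use S(2)[OF that] in simp)
  then obtain T where T: "\<And>g. g \<in> S \<Longrightarrow> Q g (T g)" by metis
  note T = T[unfolded Q_def, THEN conjunct1] T[unfolded Q_def, THEN conjunct2, THEN conjunct1]
    T[unfolded Q_def, THEN conjunct2, THEN conjunct2, rule_format]
  define U where "U = (\<Union>g\<in>S. T g)"
  \<comment> \<open>The trailing factor \<open>3 ^ k r\<close> is harmless, because multiplication
    by a power of 3 never increases the defect.\<close>
  have sound: "\<exists>n>0. defect n < s \<and> mpoly_eval f (\<lambda>i. 3 ^ k i) * 3 ^ k r = int n"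
    if "(r, f) \<in> U" for r f and k :: "nat \<Rightarrow> nat"
  proof -
    obtain g where g: "g \<in> S" "(r, f) \<in> T g" using \<open>(r, f) \<in> U\<close> by (auto simp: U_def)
    obtain q F C where gF: "g = (q, F, C)" by (cases g)
    obtain k' where k': "mpoly_eval f (\<lambda>i. 3 ^ k i) = int (F k')"
      "real C + 3 * real (\<Sum>i<q. k' i) - 3 * log 3 (real (F k')) < s"
      using T(3)[OF g(1), of "mpoly_eval f (\<lambda>i. 3 ^ k i)"] g(2) unfolding gF fst_conv snd_conv by blast
    have F: "0 < F k'" "complexity (F k') \<le> C + 3 * (\<Sum>i<q. k' i)"
      using S(2)[OF g(1)] by (auto simp: gF low_defect_family_def)
    have "real (complexity (F k')) \<le> real C + 3 * real (\<Sum>i<q. k' i)"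
      using F(2) by (metis of_nat_le_iff of_nat_add of_nat_mult of_nat_numeral)
    then have "defect (F k') < s" using k'(2) by (simp add: defect_def)
    then have "defect (F k' * 3 ^ k r) < s" using defect_mult_pow3_le[OF F(1), of "k r"] by simp
    then show ?thesis using F(1) k'(1) by (intro exI[of _ "F k' * 3 ^ k r"]) simp
  qed
  have complete: "\<exists>(r, f)\<in>U. \<exists>k :: nat \<Rightarrow> nat. int n = mpoly_eval f (\<lambda>i. 3 ^ k i) * 3 ^ k r"
    if n: "0 < n" "defect n < s" for n
  proof -
    obtain g where g: "g \<in> S" "represents g n" using S(3) n by blast
    obtain q F C where gF: "g = (q, F, C)" by (cases g)
    obtain k' where k': "n = F k'" "complexity n = C + 3 * (\<Sum>i<q. k' i)"
      using g(2) by (auto simp: gF represents_def)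
    have "real C + 3 * real (\<Sum>i<q. k' i) - 3 * log 3 (real (F k')) < s"
      using n(2) k' by (simp add: defect_def)
    then have "\<exists>(r, f)\<in>T g. \<exists>k. int n = mpoly_eval f (\<lambda>i. 3 ^ k i)"
      using T(3)[OF g(1), of "int n"] gF k'(1) by auto
    then obtain r f k where f: "(r, f) \<in> T g" "int n = mpoly_eval f (\<lambda>i. 3 ^ k i)" by auto
    have r: "mpoly_vars f \<subseteq> {..<r}" using T(2)[OF g(1)] f(1) by auto
    \<comment> \<open>The polynomial already yields \<open>n\<close>, so the trailing exponent is
      set to 0; this does not affect \<open>f\<close>, whose variables have index below
      \<open>r\<close>.\<close>
    have "mpoly_eval f (\<lambda>i. 3 ^ (k(r := 0)) i) = mpoly_eval f (\<lambda>i. 3 ^ k i)"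
      unfolding mpoly_eval_def
    proof (intro sum.cong prod.cong arg_cong2[of _ _ _ _ "(*)"] refl)
      fix m i assume "m \<in> Poly_Mapping.keys f" "i \<in> Poly_Mapping.keys m"
      then have "i < r" using r by (auto simp: mpoly_vars_def)
      then show "(3 ^ (k(r := 0)) i) ^ Poly_Mapping.lookup m i
          = (3 ^ k i :: int) ^ Poly_Mapping.lookup m i" by simp
    qed
    then have "int n = mpoly_eval f (\<lambda>i. 3 ^ (k(r := 0)) i) * 3 ^ (k(r := 0)) r"
      using f(2) by simp
    then show ?thesis using f(1) g(1) unfolding U_def by blast
  qed
  show ?thesis
  proof (intro exI[of _ U] conjI)
    show "finite U" using S(1) T(1) by (auto simp: U_def)
    show "\<forall>(r, f)\<in>U. mpoly_vars f \<subseteq> {..<r} \<and> multilinear f"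
    proof clarify
      fix r f assume "(r, f) \<in> U"
      then obtain g where "g \<in> S" "(r, f) \<in> T g" by (auto simp: U_def)
      then show "mpoly_vars f \<subseteq> {..<r} \<and> multilinear f" using T(2)[of g] by auto
    qed
    show "\<forall>n>0. defect n < s \<longleftrightarrow>
      (\<exists>(r, f)\<in>U. \<exists>k :: nat \<Rightarrow> nat. int n = mpoly_eval f (\<lambda>i. 3 ^ k i) * 3 ^ k r)"
    proof (intro allI impI iffI)
      fix n :: nat
      assume "\<exists>(r, f)\<in>U. \<exists>k :: nat \<Rightarrow> nat. int n = mpoly_eval f (\<lambda>i. 3 ^ k i) * 3 ^ k r"
      then obtain r f k where *: "(r, f) \<in> U" "int n = mpoly_eval f (\<lambda>i. 3 ^ k i) * 3 ^ k r" by auto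
      from sound[OF *(1), of k] show "defect n < s" by (auto simp flip: *(2))
    qed (rule complete)
    show "int ` {n. n > 0 \<and> defect n < s} =
      (\<Union>(r, f)\<in>U. {mpoly_eval f (\<lambda>i. 3 ^ k i) * 3 ^ k r | k :: nat \<Rightarrow> nat. True})"
    proof (intro equalityI subsetI)
      fix x assume "x \<in> int ` {n. n > 0 \<and> defect n < s}"
      then obtain n where n: "x = int n" "0 < n" "defect n < s" by auto
      from complete[OF n(2,3)]
      show "x \<in> (\<Union>(r, f)\<in>U. {mpoly_eval f (\<lambda>i. 3 ^ k i) * 3 ^ k r | k :: nat \<Rightarrow> nat. True})"
        unfolding n(1) by blast
    next
      fix x assume "x \<in> (\<Union>(r, f)\<in>U. {mpoly_eval f (\<lambda>i. 3 ^ k i) * 3 ^ k r | k :: nat \<Rightarrow> nat. True})"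
      then obtain r f k where *: "(r, f) \<in> U" "x = mpoly_eval f (\<lambda>i. 3 ^ k i) * 3 ^ k r" by auto
      from sound[OF *(1), of k] show "x \<in> int ` {n. n > 0 \<and> defect n < s}"
        by (auto simp flip: *(2))
    qed
  qed
qed

end
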